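(* Let $\mathcal I$ be an ideal on $\mathbb N$. Let $(a_k)_{k\in\mathbb N}$ be a sequence of reals tending to infinity and let $(m_k)_{k\in\mathbb N}$ be an increasing sequence of positive integers such that $m_k\geq k^{a_k}$ for each $k$. Let $M=\{m_k: k\in \mathbb N\}$. (1) If $M \in\mathcal I^+$, then $AOS(\mathcal I)$ and $AOS(\mathcal I^* )$ are strongly $\mathfrak c$-algebrable. (2) If $M\in\mathcal I^*$, then $AOS(\mathcal I^+)$ is strongly $\mathfrak c$-algebrable.
   Context: $\mathbb N=\{1,2,\dots\}$; $\mathfrak c$ is the cardinality of the continuum. An ideal on $\mathbb N$ is a nonempty family $\mathcal I\subseteq\mathcal P(\mathbb N)$ closed under subsets and finite unions, containing all finite subsets of $\mathbb N$, with $\mathbb N\notin\mathcal I$. $\mathcal I^*=\{\mathbb N\setminus A: A\in\mathcal I\}$ is the dual filter and $\mathcal I^+=\{A\subseteq\mathbb N:A\notin\mathcal I\}$ is the coideal. For a real sequence $(x_n)$: $(x_n)$ is $\mathcal I$-convergent to $0$ if $\{n:|x_n|\ge\varepsilon\}\in\mathcal I$ for every $\varepsilon>0$; it is $\mathcal I^*$-convergent (resp. $\mathcal I^+$-convergent) to $0$ if there is $F\in\mathcal I^*$ (resp. $F\in\mathcal I^+$) such that the subsequence $(x_n)_{n\in F}$ converges to $0$ in the ordinary sense. $\ell_1$ is the Banach algebra of real sequences with absolutely convergent series, with norm $\lVert(a_n)\rVert=\sum_{n=1}^\infty|a_n|$ and coordinatewise addition and multiplication (a commutative algebra without unit; subalgebras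 are not required to be unital). $AOS(\mathcal I)$ (resp. $AOS(\mathcal I^* )$, $AOS(\mathcal I^+)$) is the set of all $(a_n)\in\ell_1$ such that $(na_n)$ is not $\mathcal I$-convergent (resp. not $\mathcal I^*$-convergent, not $\mathcal I^+$-convergent) to zero. A subset $Y\subseteq\ell_1$ is strongly $\kappa$-algebrable if $Y\cup\{0\}$ contains a $\kappa$-generated subalgebra which is a free (commutative, non-unital) algebra; that is, there is a set $Z\subseteq\ell_1$ of cardinality $\kappa$ such that for all $q\in\mathbb N$, pairwise distinct $z_1,\dots,z_q\in Z$ and every nonzero real polynomial $P$ in $q$ variables without constant term, $P(z_1,\dots,z_q)\in Y\setminus\{0\}$. *)

theory Defs
  imports Complex_Main "HOL-Library.Infinite_Set" "HOL-Library.Equipollence"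
    "HOL-Library.Poly_Mapping"
begin

text \<open>The index set is \<open>{1..}\<close>, a subset of \<^typ>\<open>nat\<close>. A sequence is a function on \<^typ>\<open>nat\<close>
  whose value at \<open>0\<close> is never inspected, or, in \<open>ell1\<close>, is fixed to be \<open>0\<close>.\<close>

definition ideal_on_pos :: "nat set set \<Rightarrow> bool" where
  "ideal_on_pos I \<longleftrightarrow>
     I \<noteq> {} \<and> I \<subseteq> Pow {1..} \<and>
     (\<forall>A\<in>I. \<forall>B. B \<subseteq> A \<longrightarrow> B \<in> I) \<and>
     (\<forall>A\<in>I. \<forall>B\<in>I. A \<union> B \<in> I) \<and>
     (\<forall>A. A \<subseteq> {1..} \<and> finite A \<longrightarrow> A \<in> I) \<and>
     {1..} \<notin> I"

definition dual_filter :: "nat set set \<Rightarrow> nat set set" where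
  "dual_filter I = {{1..} - A |A. A \<in> I}"

definition coideal :: "nat set set \<Rightarrow> nat set set" where
  "coideal I = {A. A \<subseteq> {1..} \<and> A \<notin> I}"

definition ideal_conv_zero :: "nat set set \<Rightarrow> (nat \<Rightarrow> real) \<Rightarrow> bool" where
  "ideal_conv_zero I x \<longleftrightarrow> (\<forall>\<epsilon>>0. {n \<in> {1..}. \<bar>x n\<bar> \<ge> \<epsilon>} \<in> I)"

text \<open>Members of \<open>dual_filter I\<close> and of \<open>coideal I\<close> are infinite when \<open>I\<close> is an ideal, so
  \<^const>\<open>enumerate\<close> lists such a set increasingly and \<open>\<lambda>k. x (enumerate F k)\<close> is the
  subsequence of \<open>x\<close> with indices in \<open>F\<close>.\<close>

definition conv_zero_along :: "nat set set \<Rightarrow> (nat \<Rightarrow> real) \<Rightarrow> bool" where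
  "conv_zero_along \<F> x \<longleftrightarrow> (\<exists>F\<in>\<F>. (\<lambda>k. x (enumerate F k)) \<longlonglongrightarrow> 0)"

definition ell1 :: "(nat \<Rightarrow> real) set" where
  "ell1 = {a. a 0 = 0 \<and> summable (\<lambda>n. \<bar>a n\<bar>)}"

definition AOS :: "nat set set \<Rightarrow> (nat \<Rightarrow> real) set" where
  "AOS I = {a \<in> ell1. \<not> ideal_conv_zero I (\<lambda>n. real n * a n)}"

definition AOS_dual :: "nat set set \<Rightarrow> (nat \<Rightarrow> real) set" where
  "AOS_dual I = {a \<in> ell1. \<not> conv_zero_along (dual_filter I) (\<lambda>n. real n * a n)}"

definition AOS_coideal :: "nat set set \<Rightarrow> (nat \<Rightarrow> real) set" where
  "AOS_coideal I = {a \<in> ell1. \<not> conv_zero_along (coideal I) (\<lambda>n. real n * a n)}"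

text \<open>A real polynomial is a finitely supported map from monomials to coefficients, a monomial
  being a finitely supported map from variable indices to exponents. In particular the monomial
  \<open>0\<close> is the one of the constant term.\<close>

type_synonym real_mpoly = "(nat \<Rightarrow>\<^sub>0 nat) \<Rightarrow>\<^sub>0 real"

definition mpoly_in_vars :: "nat set \<Rightarrow> real_mpoly \<Rightarrow> bool" where
  "mpoly_in_vars V P \<longleftrightarrow> (\<forall>\<mu>\<in>Poly_Mapping.keys P. Poly_Mapping.keys \<mu> \<subseteq> V)"

text \<open>Evaluation at a family of sequences \<open>z\<close>, with coordinatewise operations.\<close>

definition eval_mpoly :: "real_mpoly \<Rightarrow> (nat \<Rightarrow> nat \<Rightarrow> real) \<Rightarrow> nat \<Rightarrow> real" where
  "eval_mpoly P z = (\<lambda>n. \<Sum>\<mu>\<in>Poly_Mapping.keys P. Poly_Mapping.lookup P \<mu> *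
     (\<Prod>i\<in>Poly_Mapping.keys \<mu>. z i n ^ Poly_Mapping.lookup \<mu> i))"

text \<open>The cardinal \<open>\<kappa>\<close> is represented by any set \<open>K\<close> of that cardinality.\<close>

definition strongly_algebrable :: "'k set \<Rightarrow> (nat \<Rightarrow> real) set \<Rightarrow> bool" where
  "strongly_algebrable K Y \<longleftrightarrow>
     (\<exists>Z. Z \<subseteq> ell1 \<and> Z \<approx> K \<and>
        (\<forall>q\<ge>1. \<forall>z. inj_on z {1..q} \<and> z ` {1..q} \<subseteq> Z \<longrightarrow>
           (\<forall>P. P \<noteq> 0 \<and> mpoly_in_vars {1..q} P \<and> Poly_Mapping.lookup P 0 = 0 \<longrightarrow>
              eval_mpoly P z \<in> Y - {\<lambda>_. 0})))"

end

theory Submission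
  imports Defs "HOL-Analysis.Complex_Transcendental" "HOL-Real_Asymp.Real_Asymp"
begin

text \<open>For \<open>0 < s < 1\<close> let \<open>z\<^sub>s\<close> vanish off \<open>M\<close> and take the value
  \<open>exp (- (2 ln k + (ln k) powr s))\<close> at \<open>m\<^sub>k\<close>; it is summable because of the factor \<open>k powr (-2)\<close>.
  A monomial in such sequences equals \<open>exp (- E (ln k))\<close> at \<open>m\<^sub>k\<close>, where \<open>E\<close> is a sum of
  real powers, and for two distinct monomials the difference of the exponents \<open>E\<close> tends
  to plus or minus infinity. Hence in a nonzero polynomial a single monomial dominates, and it is
  at least \<open>k powr (-C)\<close> for some constant \<open>C\<close>. Since \<open>m\<^sub>k \<ge> k powr a\<^sub>k\<close> and \<open>a\<^sub>k\<close> tends to infinity,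
  the product of the index with the value of the polynomial tends to infinity in absolute
  value along \<open>M\<close>.\<close>

section \<open>Growth of sums of real powers and of exponentials\<close>

text \<open>Among the terms with nonzero coefficient, the one with the largest exponent wins.
  Factoring out its power leaves negative exponents in the others, so the cofactor tends to its
  coefficient \<open>d j\<close>, whose sign decides between the two alternatives.\<close>

lemma powr_sum_at_top_or_at_bot:
  fixes d s :: "'i \<Rightarrow> real"
  assumes "finite V" and "inj_on s V" and "\<forall>i\<in>V. s i > 0" and "\<exists>i\<in>V. d i \<noteq> 0"
  shows "filterlim (\<lambda>t. \<Sum>i\<in>V. d i * t powr s i) at_top at_top \<or>
         filterlim (\<lambda>t. \<Sum>i\<in>V. d i * t powr s i) at_bot at_top"
proof -
  define W where "W = {i\<in>V. d i \<noteq> 0}"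
  have W: "finite W" "W \<noteq> {}" "W \<subseteq> V" using assms by (auto simp: W_def)
  obtain j where j: "j \<in> W" "\<forall>i\<in>W. s i \<le> s j"
    using finite_has_maximal[of "s ` W"] W by (fastforce dest: Max_ge intro: that)
  have lt: "s i < s j" if "i \<in> W - {j}" for i
    using that j W assms(2) by (metis DiffE inj_on_contraD insertCI less_eq_real_def subsetD)
  have sum_eq: "(\<Sum>i\<in>V. d i * t powr s i) = (\<Sum>i\<in>W. d i * t powr s i)" for t
    using assms(1) by (intro sum.mono_neutral_right) (auto simp: W_def)
  have "((\<lambda>t. d j + (\<Sum>i\<in>W-{j}. d i * t powr (s i - s j))) \<longlongrightarrow>
          d j + (\<Sum>i\<in>W-{j}. d i * 0)) at_top"
    using lt by (intro tendsto_intros tendsto_neg_powr filterlim_ident) auto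
  then have lim: "((\<lambda>t. d j + (\<Sum>i\<in>W-{j}. d i * t powr (s i - s j))) \<longlongrightarrow> d j) at_top"
    by simp
  have top: "filterlim (\<lambda>t::real. t powr s j) at_top at_top"
    using assms(3) j W by (intro real_powr_at_top) auto
  have ev: "\<forall>\<^sub>F t in at_top. (d j + (\<Sum>i\<in>W-{j}. d i * t powr (s i - s j))) * t powr s j
               = (\<Sum>i\<in>V. d i * t powr s i)"
    using eventually_gt_at_top[of 0]
  proof eventually_elim
    case (elim t)
    show ?case
      unfolding sum_eq sum.remove[OF W(1) j(1)]
      using elim by (simp add: distrib_right sum_distrib_right powr_diff)
  qed
  consider "d j > 0" | "d j < 0" using j by (force simp: W_def)
  then show ?thesis
  proof cases
    case 1
    from filterlim_tendsto_pos_mult_at_top[OF lim 1 top] show ?thesis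
      using filterlim_cong[OF refl refl ev] by blast
  next
    case 2
    from filterlim_tendsto_neg_mult_at_bot[OF lim 2 top] show ?thesis
      using filterlim_cong[OF refl refl ev] by blast
  qed
qed

text \<open>Divergence of differences to plus infinity is a transitive relation, total on
  \<open>S\<close> by assumption, so a finite \<open>S\<close> has a least element. In the induction
  a new \<open>x\<close> either lies above the old minimum or, by transitivity, becomes the
  minimum.\<close>

lemma ex_dominated_by_all:
  fixes E :: "'b \<Rightarrow> 'c \<Rightarrow> real"
  assumes "finite S" and "S \<noteq> {}"
    and "\<And>\<mu> \<nu>. \<mu> \<in> S \<Longrightarrow> \<nu> \<in> S \<Longrightarrow> \<mu> \<noteq> \<nu> \<Longrightarrow>
           filterlim (\<lambda>k. E \<nu> k - E \<mu> k) at_top F \<or> filterlim (\<lambda>k. E \<nu> k - E \<mu> k) at_bot F"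
  shows "\<exists>\<mu>\<in>S. \<forall>\<nu>\<in>S - {\<mu>}. filterlim (\<lambda>k. E \<nu> k - E \<mu> k) at_top F"
  using assms
proof (induction S rule: finite_ne_induct)
  case (singleton x)
  then show ?case by simp
next
  case (insert x S)
  then obtain \<mu> where \<mu>: "\<mu> \<in> S" "\<forall>\<nu>\<in>S - {\<mu>}. filterlim (\<lambda>k. E \<nu> k - E \<mu> k) at_top F"
    by blast
  have "x \<noteq> \<mu>" using insert \<mu> by blast
  then consider "filterlim (\<lambda>k. E x k - E \<mu> k) at_top F" | "filterlim (\<lambda>k. E x k - E \<mu> k) at_bot F"
    using insert.prems[of \<mu> x] \<mu> by auto
  then show ?case
  proof cases
    case 1
    then show ?thesis using \<mu> by auto
  next
    case 2
    then have 2: "filterlim (\<lambda>k. E \<mu> k - E x k) at_top F"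
      by (simp add: filterlim_uminus_at_top)
    have "filterlim (\<lambda>k. E \<nu> k - E x k) at_top F" if "\<nu> \<in> S" for \<nu>
    proof (cases "\<nu> = \<mu>")
      case False
      then have "filterlim (\<lambda>k. E \<nu> k - E \<mu> k) at_top F" using \<mu> that by blast
      from filterlim_at_top_add_at_top[OF this 2] show ?thesis by simp
    qed (use 2 in simp)
    then show ?thesis by (intro bexI[of _ x]) auto
  qed
qed

text \<open>The least exponent \<open>E \<mu>\<close> belongs to the largest term. Rescaling by
  \<open>exp (E \<mu> k)\<close> makes this term constant and sends every other one to 0.\<close>

lemma exp_sum_dominant_term:
  fixes E :: "'b \<Rightarrow> 'c \<Rightarrow> real" and c :: "'b \<Rightarrow> real"
  assumes "finite S" and "S \<noteq> {}"
    and "\<And>\<mu> \<nu>. \<mu> \<in> S \<Longrightarrow> \<nu> \<in> S \<Longrightarrow> \<mu> \<noteq> \<nu> \<Longrightarrow>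
           filterlim (\<lambda>k. E \<nu> k - E \<mu> k) at_top F \<or> filterlim (\<lambda>k. E \<nu> k - E \<mu> k) at_bot F"
  shows "\<exists>\<mu>\<in>S. ((\<lambda>k. exp (E \<mu> k) * (\<Sum>\<nu>\<in>S. c \<nu> * exp (- E \<nu> k))) \<longlongrightarrow> c \<mu>) F"
proof -
  obtain \<mu> where \<mu>: "\<mu> \<in> S" and dom: "\<forall>\<nu>\<in>S - {\<mu>}. filterlim (\<lambda>k. E \<nu> k - E \<mu> k) at_top F"
    using ex_dominated_by_all[of S E F] assms by blast
  have "((\<lambda>k. exp (- (E \<nu> k - E \<mu> k))) \<longlongrightarrow> 0) F" if "\<nu> \<in> S - {\<mu>}" for \<nu>
    by (rule filterlim_compose[OF exp_at_bot])
       (use dom that in \<open>auto simp: filterlim_uminus_at_top\<close>)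
  then have "((\<lambda>k. c \<mu> + (\<Sum>\<nu>\<in>S-{\<mu>}. c \<nu> * exp (- (E \<nu> k - E \<mu> k)))) \<longlongrightarrow>
          c \<mu> + (\<Sum>\<nu>\<in>S-{\<mu>}. c \<nu> * 0)) F"
    by (intro tendsto_add tendsto_sum tendsto_mult tendsto_const)
  also have "(\<lambda>k. c \<mu> + (\<Sum>\<nu>\<in>S-{\<mu>}. c \<nu> * exp (- (E \<nu> k - E \<mu> k)))) =
             (\<lambda>k. exp (E \<mu> k) * (\<Sum>\<nu>\<in>S. c \<nu> * exp (- E \<nu> k)))"
    unfolding sum.remove[OF assms(1) \<mu>]
    by (auto simp: fun_eq_iff distrib_left sum_distrib_left exp_diff exp_minus field_simps)
  finally show ?thesis using \<mu> by auto
qed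

section \<open>Ideals and the three notions of convergence\<close>

lemma finite_ge_if_enumerate_tendsto_0:
  fixes x :: "nat \<Rightarrow> real"
  assumes "infinite F" and "(\<lambda>k. x (enumerate F k)) \<longlonglongrightarrow> 0" and "\<epsilon> > 0"
  shows "finite {n\<in>F. \<bar>x n\<bar> \<ge> \<epsilon>}"
proof -
  obtain K where K: "\<And>k. k \<ge> K \<Longrightarrow> \<bar>x (enumerate F k)\<bar> < \<epsilon>"
    using LIMSEQ_D[OF assms(2,3)] by auto
  have "{n\<in>F. \<bar>x n\<bar> \<ge> \<epsilon>} \<subseteq> enumerate F ` {..<K}"
  proof
    fix n assume n: "n \<in> {n\<in>F. \<bar>x n\<bar> \<ge> \<epsilon>}"
    then obtain k where "n = enumerate F k"
      using range_enumerate[OF assms(1)] by blast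
    with n K[of k] show "n \<in> enumerate F ` {..<K}" by force
  qed
  then show ?thesis by (rule finite_subset) simp
qed

text \<open>Convergence along \<open>F\<close> would leave only finitely many indices of
  \<open>F\<close> with values of size at least \<open>\<epsilon>\<close>, while \<open>M\<close>
  has only finitely many with smaller values; together these would exhaust the infinite set
  \<open>F \<inter> M\<close>.\<close>

lemma not_conv_zero_along:
  fixes x :: "nat \<Rightarrow> real"
  assumes "\<epsilon> > 0" and "finite {n\<in>M. \<bar>x n\<bar> < \<epsilon>}" and "\<And>F. F \<in> \<F> \<Longrightarrow> infinite (F \<inter> M)"
  shows "\<not> conv_zero_along \<F> x"
proof
  assume "conv_zero_along \<F> x"
  then obtain F where F: "F \<in> \<F>" "(\<lambda>k. x (enumerate F k)) \<longlonglongrightarrow> 0"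
    by (auto simp: conv_zero_along_def)
  have inf: "infinite (F \<inter> M)" using F assms by blast
  then have "finite {n\<in>F. \<bar>x n\<bar> \<ge> \<epsilon>}"
    using finite_ge_if_enumerate_tendsto_0[OF _ F(2) assms(1)] by blast
  then have "finite ({n\<in>F. \<bar>x n\<bar> \<ge> \<epsilon>} \<union> {n\<in>M. \<bar>x n\<bar> < \<epsilon>})" using assms by blast
  then have "finite (F \<inter> M)" by (rule rev_finite_subset) auto
  with inf show False by blast
qed

lemma ideal_almost_subset:
  assumes "ideal_on_pos I" and "A \<in> I" and "finite B" and "C \<subseteq> A \<union> B" and "C \<subseteq> {1..}"
  shows "C \<in> I"
proof -
  have down: "\<And>A B. A \<in> I \<Longrightarrow> B \<subseteq> A \<Longrightarrow> B \<in> I"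
    and un: "\<And>A B. A \<in> I \<Longrightarrow> B \<in> I \<Longrightarrow> A \<union> B \<in> I"
    and fin: "\<And>A. A \<subseteq> {1..} \<Longrightarrow> finite A \<Longrightarrow> A \<in> I"
    using assms(1) by (simp_all add: ideal_on_pos_def)
  \<comment> \<open>The finite set may contain 0, which no member of \<open>I\<close> does, so it is
    first cut down to positive indices.\<close>
  have "B \<inter> {1..} \<in> I" by (rule fin) (use assms(3) in simp_all)
  then have "A \<union> (B \<inter> {1..}) \<in> I" by (rule un[OF assms(2)])
  then show ?thesis by (rule down) (use assms(4,5) in blast)
qed

lemma not_ideal_conv_zero:
  assumes "ideal_on_pos I" and "M \<in> coideal I" and "\<epsilon> > 0" and "finite {n\<in>M. \<bar>x n\<bar> < \<epsilon>}"
  shows "\<not> ideal_conv_zero I x"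
proof
  assume "ideal_conv_zero I x"
  then have "{n\<in>{1..}. \<bar>x n\<bar> \<ge> \<epsilon>} \<in> I" using assms by (auto simp: ideal_conv_zero_def)
  from ideal_almost_subset[OF assms(1) this assms(4), of M] show False
    using assms(2) by (force simp: coideal_def)
qed

text \<open>Otherwise \<open>A\<close> would be covered by the complement of \<open>B\<close>, a
  member of \<open>I\<close>, and a finite set. The lemma serves both dual notions: \<open>M\<close>
  plays the role of \<open>A\<close> for \<open>AOS_dual\<close> and that of \<open>B\<close> for
  \<open>AOS_coideal\<close>.\<close>

lemma infinite_coideal_Int_dual_filter:
  assumes "ideal_on_pos I" and "A \<in> coideal I" and "B \<in> dual_filter I"
  shows "infinite (A \<inter> B)"
proof
  assume fin: "finite (A \<inter> B)"
  obtain C where C: "C \<in> I" "B = {1..} - C" using assms by (auto simp: dual_filter_def)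
  have "A \<in> I" using ideal_almost_subset[OF assms(1) C(1) fin, of A] C assms(2)
    by (auto simp: coideal_def)
  then show False using assms(2) by (auto simp: coideal_def)
qed

section \<open>The generating sequences\<close>

text \<open>The sequence \<open>m\<close>, indexed from \<open>1\<close>, enters as \<open>g k = m (Suc k)\<close>.\<close>

definition generator :: "(nat \<Rightarrow> nat) \<Rightarrow> real \<Rightarrow> nat \<Rightarrow> real" where
  "generator g s n = (if n \<in> range g then
     let t = ln (real (Suc (inv g n))) in exp (- (2 * t + t powr s)) else 0)"

lemma generator_at:
  assumes "inj g"
  shows "generator g s (g k) =
    exp (- (2 * ln (real (Suc k)) + ln (real (Suc k)) powr s))"
  using assms by (simp add: generator_def Let_def)

lemma generator_nonneg: "generator g s n \<ge> 0"
  by (simp add: generator_def Let_def)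

text \<open>This bound later allows all factors of a monomial but one to be discarded when proving
  summability.\<close>

lemma generator_le_1: "generator g s n \<le> 1"
proof -
  have "0 \<le> 2 * ln (real (Suc k)) + ln (real (Suc k)) powr s" for k by simp
  then show ?thesis unfolding generator_def Let_def
    by (simp only: exp_le_one_iff neg_le_0_iff_le split: if_split) simp
qed

lemma generator_in_ell1:
  assumes "strict_mono g" and "g 0 \<ge> 1"
  shows "generator g s \<in> ell1"
proof -
  have inj: "inj g" using assms(1) by (rule strict_mono_imp_inj_on)
  have "summable (\<lambda>k. generator g s (g k))"
  proof (rule summable_comparison_test')
    show "summable (\<lambda>k. inverse (real (Suc k) ^ 2))"
      using inverse_power_summable[of 2, where ?'a=real] by (subst summable_Suc_iff) simp
    show "norm (generator g s (g k)) \<le> inverse (real (Suc k) ^ 2)" for k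
    proof -
      have "exp (- (2 * ln (real (Suc k)) + ln (real (Suc k)) powr s)) \<le>
            exp (- (2 * ln (real (Suc k))))" by simp
      also have "\<dots> = inverse (exp (ln (real (Suc k))) ^ 2)"
        by (simp only: exp_minus exp_double)
      finally show ?thesis using inj by (simp add: generator_at)
    qed
  qed
  \<comment> \<open>Summability along the increasing \<open>g\<close> is summability outright, since
    the sequence vanishes off \<open>range g\<close>.\<close>
  then have "summable (generator g s)"
    using summable_mono_reindex[OF assms(1), of "generator g s"]
    by (simp add: generator_def)
  moreover have "0 \<notin> range g"
    using assms by (metis imageE le_zero_eq not_one_le_zero order_trans strict_mono_less_eq zero_le)
  ultimately show ?thesis by (auto simp: ell1_def generator_nonneg) (simp add: generator_def)
qed

lemma generator_inj:
  assumes "inj g"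
  shows "inj_on (generator g) {0<..<1}"
proof (rule inj_onI)
  fix s s' :: real
  assume eq: "generator g s = generator g s'"
  \<comment> \<open>At \<open>g 2\<close> the power has base \<open>ln 3\<close>, which exceeds 1,
    so its value determines the exponent.\<close>
  have "ln 3 powr s = ln 3 powr s'"
    using fun_cong[OF eq, of "g 2"] assms by (simp add: generator_at)
  moreover have "ln (3::real) > 1"
    by (rule ln3_gt_1)
  ultimately show "s = s'" by (simp add: powr_inj)
qed

section \<open>Polynomials in the generators\<close>

text \<open>The exponent of a monomial in generators, as a function of \<open>t = ln k\<close>.\<close>

definition monomial_exponent :: "(nat \<Rightarrow> real) \<Rightarrow> (nat \<Rightarrow>\<^sub>0 nat) \<Rightarrow> real \<Rightarrow> real" where
  "monomial_exponent s \<mu> t =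
     (\<Sum>i\<in>Poly_Mapping.keys \<mu>. real (Poly_Mapping.lookup \<mu> i) * (2 * t + t powr s i))"

lemma monomial_exponent_eq:
  assumes "finite V" and "Poly_Mapping.keys \<mu> \<subseteq> V"
  shows "monomial_exponent s \<mu> t =
    (\<Sum>i\<in>V. real (Poly_Mapping.lookup \<mu> i) * (2 * t + t powr s i))"
  unfolding monomial_exponent_def using assms
  by (intro sum.mono_neutral_left) (auto simp: in_keys_iff)

text \<open>For positive \<open>t\<close> the difference is a combination of the powers
  \<open>t powr s i\<close> and of \<open>t\<close> itself. All \<open>s i\<close> are distinct and
  below 1, so the linear term cannot cancel any of them, and a variable in which the monomials
  differ supplies a nonzero coefficient.\<close>

lemma monomial_exponent_diff:
  assumes "inj_on s {1..q}" and "s ` {1..q} \<subseteq> {0<..<1}"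
    and "Poly_Mapping.keys \<mu> \<subseteq> {1..q}" and "Poly_Mapping.keys \<nu> \<subseteq> {1..q}" and "\<mu> \<noteq> \<nu>"
  defines "D \<equiv> \<lambda>t. monomial_exponent s \<nu> t - monomial_exponent s \<mu> t"
  shows "filterlim D at_top at_top \<or> filterlim D at_bot at_top"
proof -
  define e where "e i = real (Poly_Mapping.lookup \<nu> i) - real (Poly_Mapping.lookup \<mu> i)" for i
  \<comment> \<open>The index \<open>0\<close> is free to carry the linear term \<open>t powr 1\<close>.\<close>
  define d where "d = e(0 := 2 * (\<Sum>i\<in>{1..q}. e i))"
  define s' where "s' = s(0 := 1)"
  obtain i where i: "Poly_Mapping.lookup \<mu> i \<noteq> Poly_Mapping.lookup \<nu> i"
    using assms(5) poly_mapping_eqI[of \<mu> \<nu>] by auto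
  then have iq: "i \<in> {1..q}" using assms(3,4) by (metis in_keys_iff subsetD)
  have "filterlim (\<lambda>t. \<Sum>i\<in>insert 0 {1..q}. d i * t powr s' i) at_top at_top \<or>
        filterlim (\<lambda>t. \<Sum>i\<in>insert 0 {1..q}. d i * t powr s' i) at_bot at_top"
  proof (rule powr_sum_at_top_or_at_bot)
    have s'_image: "s' ` {1..q} = s ` {1..q}" unfolding s'_def by (intro image_cong) auto
    have "s' 0 \<notin> s' ` {1..q}"
      unfolding s'_image using assms(2) by (auto simp: s'_def subset_iff)
    moreover have "inj_on s' {1..q}"
      using assms(1) by (rule inj_on_cong[THEN iffD2, rotated]) (auto simp: s'_def)
    ultimately show "inj_on s' (insert 0 {1..q})" by (subst inj_on_insert) auto
    show "\<forall>i\<in>insert 0 {1..q}. s' i > 0" using assms(2) by (auto simp: s'_def)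
    show "\<exists>i\<in>insert 0 {1..q}. d i \<noteq> 0"
      using i iq by (intro bexI[of _ i]) (auto simp: d_def e_def)
  qed simp
  moreover have "\<forall>\<^sub>F t in at_top. (\<Sum>i\<in>insert 0 {1..q}. d i * t powr s' i) = D t"
    using eventually_gt_at_top[of 0]
  proof eventually_elim
    case (elim t)
    have "D t = (\<Sum>i\<in>{1..q}. e i * (2 * t + t powr s i))"
      using assms(3,4)
      by (simp add: D_def monomial_exponent_eq[of "{1..q}"] e_def left_diff_distrib sum_subtractf)
    also have "\<dots> = 2 * (\<Sum>i\<in>{1..q}. e i) * t + (\<Sum>i\<in>{1..q}. e i * t powr s i)"
      by (simp add: distrib_left sum.distrib sum_distrib_left sum_distrib_right mult_ac)
    also have "\<dots> = (\<Sum>i\<in>insert 0 {1..q}. d i * t powr s' i)"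
      using elim by (simp add: d_def s'_def)
    finally show ?case by simp
  qed
  ultimately show ?thesis by (simp add: filterlim_cong[OF refl refl])
qed

text \<open>With \<open>t = ln k\<close> a linear bound on the exponent is a lower bound
  \<open>k powr (-C)\<close> for the monomial. The factor 3 is 2 plus 1, the latter from
  \<open>t powr s i \<le> t\<close>.\<close>

lemma monomial_exponent_le:
  assumes "t \<ge> 1" and "\<forall>i\<in>Poly_Mapping.keys \<mu>. s i \<le> 1"
  shows "monomial_exponent s \<mu> t \<le> (\<Sum>i\<in>Poly_Mapping.keys \<mu>. real (Poly_Mapping.lookup \<mu> i) * 3) * t"
proof -
  have "t powr s i \<le> t" if "i \<in> Poly_Mapping.keys \<mu>" for i
    using powr_mono[of "s i" 1 t] that assms by simp
  then show ?thesis
    unfolding monomial_exponent_def sum_distrib_right mult.assoc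
    by (intro sum_mono mult_left_mono) auto
qed

lemma eval_mpoly_generator:
  assumes "inj g"
  shows "eval_mpoly P (\<lambda>i. generator g (s i)) (g k) =
    (\<Sum>\<mu>\<in>Poly_Mapping.keys P. Poly_Mapping.lookup P \<mu> *
       exp (- monomial_exponent s \<mu> (ln (real (Suc k)))))"
proof -
  have "(\<Prod>i\<in>Poly_Mapping.keys \<mu>. generator g (s i) (g k) ^ Poly_Mapping.lookup \<mu> i) =
        exp (- monomial_exponent s \<mu> (ln (real (Suc k))))" for \<mu>
    unfolding monomial_exponent_def sum_negf[symmetric] generator_at[OF assms]
    by (simp only: exp_sum[OF finite_keys] exp_of_nat_mult[symmetric] mult_minus_right)
  then show ?thesis by (simp add: eval_mpoly_def)
qed

text \<open>Without constant term, every monomial contains some variable \<open>j\<close>. The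
  remaining factors are at most 1 in absolute value, so the monomial is dominated by
  \<open>z j\<close>, which gives both summability and the value 0 at index 0.\<close>

lemma eval_mpoly_in_ell1:
  assumes "\<And>i. i \<in> V \<Longrightarrow> z i \<in> ell1" and "\<And>i n. i \<in> V \<Longrightarrow> \<bar>z i n\<bar> \<le> 1"
    and "mpoly_in_vars V P" and "Poly_Mapping.lookup P 0 = 0"
  shows "eval_mpoly P z \<in> ell1"
proof -
  define T where "T \<mu> n = (\<Prod>i\<in>Poly_Mapping.keys \<mu>. z i n ^ Poly_Mapping.lookup \<mu> i)" for \<mu> n
  have bound: "\<exists>j\<in>V. \<forall>n. \<bar>T \<mu> n\<bar> \<le> \<bar>z j n\<bar>" if \<mu>: "\<mu> \<in> Poly_Mapping.keys P" for \<mu>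
  proof -
    have V: "Poly_Mapping.keys \<mu> \<subseteq> V" using assms(3) \<mu> by (auto simp: mpoly_in_vars_def)
    have "\<mu> \<noteq> 0" using \<mu> assms(4) by (auto simp: in_keys_iff)
    then obtain j where j: "j \<in> Poly_Mapping.keys \<mu>" by (metis all_not_in_conv keys_eq_empty)
    have "\<bar>T \<mu> n\<bar> \<le> \<bar>z j n\<bar>" for n
    proof -
      have "\<bar>T \<mu> n\<bar> = \<bar>z j n\<bar> ^ Poly_Mapping.lookup \<mu> j *
          (\<Prod>i\<in>Poly_Mapping.keys \<mu> - {j}. \<bar>z i n\<bar> ^ Poly_Mapping.lookup \<mu> i)"
        unfolding T_def using j by (subst prod.remove[of _ j]) (auto simp: abs_mult abs_prod power_abs)
      also have "\<dots> \<le> \<bar>z j n\<bar> ^ 1 * 1"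
      proof (intro mult_mono power_decreasing prod_le_1 prod_nonneg)
        show "1 \<le> Poly_Mapping.lookup \<mu> j" using j by (simp add: in_keys_iff Suc_le_eq)
      qed (use V j assms(2) in \<open>force intro!: power_le_one\<close>)+
      finally show ?thesis by simp
    qed
    then show ?thesis using j V by blast
  qed
  have eval: "eval_mpoly P z = (\<lambda>n. \<Sum>\<mu>\<in>Poly_Mapping.keys P. Poly_Mapping.lookup P \<mu> * T \<mu> n)"
    by (simp add: eval_mpoly_def T_def)
  have sT: "summable (\<lambda>n. \<bar>T \<mu> n\<bar>)" and T0: "T \<mu> 0 = 0" if \<mu>: "\<mu> \<in> Poly_Mapping.keys P" for \<mu>
  proof -
    obtain j where j: "j \<in> V" "\<forall>n. \<bar>T \<mu> n\<bar> \<le> \<bar>z j n\<bar>" using bound[OF \<mu>] by blast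
    have zj: "summable (\<lambda>n. \<bar>z j n\<bar>)" "z j 0 = 0" using assms(1)[OF j(1)] by (auto simp: ell1_def)
    show "summable (\<lambda>n. \<bar>T \<mu> n\<bar>)"
      by (rule summable_comparison_test'[OF zj(1)]) (use j in auto)
    show "T \<mu> 0 = 0" using j(2)[rule_format, of 0] zj(2) by simp
  qed
  have "summable (\<lambda>n. \<Sum>\<mu>\<in>Poly_Mapping.keys P. \<bar>Poly_Mapping.lookup P \<mu>\<bar> * \<bar>T \<mu> n\<bar>)"
    by (intro summable_sum summable_mult sT)
  then have "summable (\<lambda>n. \<bar>eval_mpoly P z n\<bar>)"
    by (rule summable_comparison_test')
       (auto simp: eval abs_mult[symmetric])
  then show ?thesis using T0 by (simp add: ell1_def eval)
qed

text \<open>With \<open>E\<close> the exponent of the dominant monomial, the product of index and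
  value splits into \<open>exp E * v k\<close>, which tends to a nonzero coefficient, and
  \<open>g k * exp (- E)\<close>. The latter is eventually at least
  \<open>exp ((a (Suc k) - C) * t k)\<close>, which tends to infinity.\<close>

lemma eval_mpoly_generator_at_top:
  assumes inj: "inj g" and a: "filterlim a at_top sequentially"
    and g: "\<And>k. real (g k) \<ge> real (Suc k) powr a (Suc k)"
    and s: "inj_on s {1..q}" "s ` {1..q} \<subseteq> {0<..<1}"
    and P: "P \<noteq> 0" "mpoly_in_vars {1..q} P"
  shows "filterlim (\<lambda>k. \<bar>real (g k) * eval_mpoly P (\<lambda>i. generator g (s i)) (g k)\<bar>) at_top sequentially"
proof -
  define t where "t k = ln (real (Suc k))" for k
  define v where "v k = eval_mpoly P (\<lambda>i. generator g (s i)) (g k)" for k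
  have t: "filterlim t at_top sequentially"
    unfolding t_def
    by (rule filterlim_compose[OF ln_at_top])
       (rule filterlim_compose[OF filterlim_real_sequentially filterlim_Suc])
  have keys: "Poly_Mapping.keys \<mu> \<subseteq> {1..q}" if "\<mu> \<in> Poly_Mapping.keys P" for \<mu>
    using that P(2) by (auto simp: mpoly_in_vars_def)
  have "\<exists>\<mu>\<in>Poly_Mapping.keys P. ((\<lambda>k. exp (monomial_exponent s \<mu> (t k)) *
      (\<Sum>\<nu>\<in>Poly_Mapping.keys P. Poly_Mapping.lookup P \<nu> * exp (- monomial_exponent s \<nu> (t k))))
        \<longlongrightarrow> Poly_Mapping.lookup P \<mu>) sequentially"
  proof (rule exp_sum_dominant_term)
    fix \<mu> \<nu> assume "\<mu> \<in> Poly_Mapping.keys P" "\<nu> \<in> Poly_Mapping.keys P" "\<mu> \<noteq> \<nu>"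
    then show "filterlim (\<lambda>k. monomial_exponent s \<nu> (t k) - monomial_exponent s \<mu> (t k)) at_top sequentially
      \<or> filterlim (\<lambda>k. monomial_exponent s \<nu> (t k) - monomial_exponent s \<mu> (t k)) at_bot sequentially"
      using monomial_exponent_diff[OF s keys keys] filterlim_compose[OF _ t] by blast
  qed (use P in auto)
  then obtain \<mu> where \<mu>: "\<mu> \<in> Poly_Mapping.keys P"
    and lim: "(\<lambda>k. exp (monomial_exponent s \<mu> (t k)) * v k) \<longlonglongrightarrow> Poly_Mapping.lookup P \<mu>"
    unfolding v_def t_def eval_mpoly_generator[OF inj] by blast
  define C where "C = (\<Sum>i\<in>Poly_Mapping.keys \<mu>. real (Poly_Mapping.lookup \<mu> i) * 3)"
  have "filterlim (\<lambda>k. (- C + a (Suc k)) * t k) at_top sequentially"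
    by (intro filterlim_at_top_mult_at_top t filterlim_tendsto_add_at_top[OF tendsto_const]
        filterlim_compose[OF a filterlim_Suc])
  then have "filterlim (\<lambda>k. exp ((- C + a (Suc k)) * t k)) at_top sequentially"
    by (rule filterlim_compose[OF exp_at_top])
  moreover have "\<forall>\<^sub>F k in sequentially. exp ((- C + a (Suc k)) * t k) \<le>
      real (g k) * exp (- monomial_exponent s \<mu> (t k))"
  proof -
    have "\<forall>\<^sub>F k in sequentially. t k \<ge> 1" using t by (simp add: filterlim_at_top)
    then show ?thesis
    proof eventually_elim
      case (elim k)
      have "\<forall>i\<in>Poly_Mapping.keys \<mu>. s i \<le> 1" using keys[OF \<mu>] s(2) by fastforce
      then have le: "monomial_exponent s \<mu> (t k) \<le> C * t k"
        unfolding C_def using monomial_exponent_le elim by blast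
      \<comment> \<open>The first factor is \<open>real (Suc k) powr a (Suc k)\<close>, hence at
        most \<open>g k\<close> by hypothesis.\<close>
      have "exp ((- C + a (Suc k)) * t k) = exp (a (Suc k) * t k) * exp (- (C * t k))"
        by (simp add: exp_add[symmetric] algebra_simps)
      also have "\<dots> \<le> real (g k) * exp (- monomial_exponent s \<mu> (t k))"
        using g[of k] le by (intro mult_mono) (auto simp: powr_def t_def)
      finally show ?case .
    qed
  qed
  ultimately have "filterlim (\<lambda>k. real (g k) * exp (- monomial_exponent s \<mu> (t k))) at_top sequentially"
    by (rule filterlim_at_top_mono)
  from filterlim_tendsto_pos_mult_at_top[OF tendsto_rabs[OF lim] _ this]
  have "filterlim (\<lambda>k. \<bar>exp (monomial_exponent s \<mu> (t k)) * v k\<bar> *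
      (real (g k) * exp (- monomial_exponent s \<mu> (t k)))) at_top sequentially"
    using \<mu> by (simp add: in_keys_iff)
  moreover have "\<bar>exp (monomial_exponent s \<mu> (t k)) * v k\<bar> *
      (real (g k) * exp (- monomial_exponent s \<mu> (t k))) = \<bar>real (g k) * v k\<bar>" for k
    by (simp add: abs_mult exp_minus)
  ultimately show ?thesis by (simp add: v_def)
qed

section \<open>Strong algebrability\<close>

text \<open>The analytic part common to all three target sets: the ideal enters only through the
  condition on \<open>Y\<close>. Continuum many generators arise because the exponents range over an
  open interval.\<close>

lemma strongly_algebrable_if_large_on_range:
  fixes g :: "nat \<Rightarrow> nat" and a :: "nat \<Rightarrow> real"
  assumes g: "strict_mono g" "g 0 \<ge> 1" and a: "filterlim a at_top sequentially"
    and large: "\<And>k. real (g k) \<ge> real (Suc k) powr a (Suc k)"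
    and Y: "\<And>x. x \<in> ell1 \<Longrightarrow> finite {n\<in>range g. \<bar>real n * x n\<bar> < 1} \<Longrightarrow> x \<in> Y"
  shows "strongly_algebrable (UNIV :: real set) Y"
proof -
  have inj: "inj g" using g(1) by (rule strict_mono_imp_inj_on)
  define Z where "Z = generator g ` {0<..<1}"
  have "bij_betw (generator g) {0<..<1} Z"
    unfolding Z_def using generator_inj[OF inj] by (rule inj_on_imp_bij_betw)
  then have "Z \<approx> {0<..<1::real}" using eqpoll_def eqpoll_sym by blast
  also have "{0<..<1::real} \<approx> (UNIV :: real set)"
    by (rule open_interval_eqpoll_reals[THEN iffD2]) simp
  finally have "Z \<approx> (UNIV :: real set)" .
  moreover have "Z \<subseteq> ell1" using generator_in_ell1[OF g] by (auto simp: Z_def)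
  moreover have "eval_mpoly P z \<in> Y - {\<lambda>_. 0}"
    if z: "inj_on z {1..q}" "z ` {1..q} \<subseteq> Z"
      and P: "P \<noteq> 0" "mpoly_in_vars {1..q} P" "Poly_Mapping.lookup P 0 = 0" for q z P
  proof -
    have ex: "\<forall>i\<in>{1..q}. \<exists>r. r \<in> {0<..<1} \<and> z i = generator g r"
    proof
      fix i assume "i \<in> {1..q}"
      then have "z i \<in> Z" using z(2) by (rule image_subset_iff[THEN iffD1, rule_format, rotated])
      then show "\<exists>r. r \<in> {0<..<1} \<and> z i = generator g r" unfolding Z_def by (rule imageE) blast
    qed
    obtain s where s: "\<forall>i\<in>{1..q}. s i \<in> {0<..<1} \<and> z i = generator g (s i)"
      using bchoice[OF ex] by blast
    have s_image: "s ` {1..q} \<subseteq> {0<..<1}" by (rule image_subsetI) (use s in blast)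
    have inj_s: "inj_on s {1..q}"
    proof (rule inj_onI)
      fix i j assume "i \<in> {1..q}" "j \<in> {1..q}" "s i = s j"
      then show "i = j" using inj_onD[OF z(1), of i j] s by metis
    qed
    have ell1: "eval_mpoly P z \<in> ell1"
      using s generator_in_ell1[OF g] generator_nonneg generator_le_1 P
      by (intro eval_mpoly_in_ell1[where V="{1..q}"]) auto
    \<comment> \<open>The chosen \<open>s\<close> is controlled only on \<open>{1..q}\<close>, but
      \<open>P\<close> involves no other variables.\<close>
    have "eval_mpoly P z = eval_mpoly P (\<lambda>i. generator g (s i))"
      using s P(2) unfolding eval_mpoly_def mpoly_in_vars_def
      by (intro ext sum.cong refl arg_cong2[where f="(*)"] prod.cong) (metis subsetD)
    then have top: "filterlim (\<lambda>k. \<bar>real (g k) * eval_mpoly P z (g k)\<bar>) at_top sequentially"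
      using eval_mpoly_generator_at_top[OF inj a large inj_s s_image P(1,2)] by (simp only:)
    then have "\<forall>\<^sub>F k in sequentially. \<bar>real (g k) * eval_mpoly P z (g k)\<bar> \<ge> 1"
      by (simp add: filterlim_at_top)
    then obtain K where K: "\<And>k. k \<ge> K \<Longrightarrow> \<bar>real (g k) * eval_mpoly P z (g k)\<bar> \<ge> 1"
      by (auto simp: eventually_sequentially)
    have "{n\<in>range g. \<bar>real n * eval_mpoly P z n\<bar> < 1} \<subseteq> g ` {..<K}"
      using K by (force simp: not_le[symmetric])
    then have "eval_mpoly P z \<in> Y" by (intro Y ell1) (rule finite_subset, auto)
    \<comment> \<open>At the index \<open>g K\<close> the product with the index is already at least
      1 in absolute value.\<close>
    moreover have "eval_mpoly P z \<noteq> (\<lambda>_. 0)" using K[of K] by auto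
    ultimately show ?thesis by blast
  qed
  ultimately show ?thesis unfolding strongly_algebrable_def by blast
qed

theorem theorem4p14:
  fixes I :: "nat set set" and a :: "nat \<Rightarrow> real" and m :: "nat \<Rightarrow> nat" and M :: "nat set"
  assumes "ideal_on_pos I"
    and "filterlim a at_top sequentially"
    and "strict_mono_on {1..} m"
    and "\<forall>k\<ge>1. m k \<ge> 1"
    and "\<forall>k\<ge>1. real (m k) \<ge> real k powr a k"
    and "M = m ` {1..}"
  shows "(M \<in> coideal I \<longrightarrow>
            strongly_algebrable (UNIV :: real set) (AOS I) \<and>
            strongly_algebrable (UNIV :: real set) (AOS_dual I)) \<and>
         (M \<in> dual_filter I \<longrightarrow> strongly_algebrable (UNIV :: real set) (AOS_coideal I))"
proof -
  define g where "g k = m (Suc k)" for k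
  have mono: "strict_mono g"
    using assms(3) by (auto simp: strict_mono_def strict_mono_on_def g_def)
  have "{1..} = range Suc" by (auto simp: image_iff) (metis Suc_le_D)
  then have M: "M = range g" using assms(6) by (auto simp: g_def)
  \<comment> \<open>It remains to show, for each target set, that it contains every \<open>x\<close>
    in \<open>ell1\<close> whose products \<open>n * x n\<close> have absolute value at least 1 at
    all but finitely many indices in \<open>M\<close>.\<close>
  have alg: "strongly_algebrable (UNIV :: real set) Y"
    if "\<And>x. x \<in> ell1 \<Longrightarrow> finite {n\<in>M. \<bar>real n * x n\<bar> < 1} \<Longrightarrow> x \<in> Y" for Y
    using that assms(4,5) unfolding M
    by (intro strongly_algebrable_if_large_on_range[OF mono _ assms(2)]) (auto simp: g_def)
  have "strongly_algebrable (UNIV :: real set) (AOS I)" if "M \<in> coideal I"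
    using not_ideal_conv_zero[OF assms(1) that zero_less_one] by (intro alg) (auto simp: AOS_def)
  moreover have "strongly_algebrable (UNIV :: real set) (AOS_dual I)" if "M \<in> coideal I"
  proof (rule alg)
    fix x assume "x \<in> ell1" "finite {n\<in>M. \<bar>real n * x n\<bar> < 1}"
    then show "x \<in> AOS_dual I"
      using not_conv_zero_along[OF zero_less_one, of M _ "dual_filter I"]
        infinite_coideal_Int_dual_filter[OF assms(1) that]
      by (auto simp: AOS_dual_def Int_commute)
  qed
  moreover have "strongly_algebrable (UNIV :: real set) (AOS_coideal I)" if "M \<in> dual_filter I"
  proof (rule alg)
    fix x assume "x \<in> ell1" "finite {n\<in>M. \<bar>real n * x n\<bar> < 1}"
    then show "x \<in> AOS_coideal I"
      using not_conv_zero_along[OF zero_less_one, of M _ "coideal I"]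
        infinite_coideal_Int_dual_filter[OF assms(1) _ that]
      by (auto simp: AOS_coideal_def)
  qed
  ultimately show ?thesis by blast
qed

end
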